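(* Let $\mathcal{H}$ be a complex Hilbert space, $P\in\mathcal{B}(\mathcal{H})$ a nonzero positive operator, $n\ge 1$, $A=[a_{ij}]\in\mathcal{M}_n(\mathbb{C})$ and $B\in\mathcal{B}_{P^{1/2}}(\mathcal{H})$. Then $$w_{I_n\otimes P}(A\otimes B)\le w(C),$$ where $C=[c_{ij}]\in\mathcal{M}_n(\mathbb{C})$ has entries $c_{ii}=|a_{ii}|\,w_P(B)$ and, for $i\ne j$, $$c_{ij}=w_{I_2\otimes P}\left(\begin{bmatrix} 0 & a_{ij} \\ {a_{ji}} & 0 \end{bmatrix}\otimes B\right).$$
   Context: An operator $P\in\mathcal{B}(\mathcal{H})$ is positive if $\langle Px,x\rangle\ge 0$ for all $x\in\mathcal{H}$. It induces the semi-inner product $\langle x,y\rangle_P=\langle Px,y\rangle$ and seminorm $\|x\|_P=\sqrt{\langle x,x\rangle_P}$ on $\mathcal{H}$. Let $\mathcal{B}_{P^{1/2}}(\mathcal{H})=\{B\in\mathcal{B}(\mathcal{H}) : \exists\lambda>0,\ \|Bx\|_P\le\lambda\|x\|_P\ \forall x\in\mathcal{H}\}$. For $B\in\mathcal{B}_{P^{1/2}}(\mathcal{H})$, the $P$-numerical radius is $w_P(B)=\sup\{|\langle Bx,x\rangle_P| : x\in\mathcal{H},\ \|x\|_P=1\}$. The same notions are used on $\mathcal{H}^n=\mathcal{H}^{\oplus n}$ with the positive operator $I_n\otimes P$ (the block diagonal operator with $n$ copies of $P$) in place of $P$. For $A=[a_{ij}]\in\mathcal{M}_n(\mathbb{C})$,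 $A\otimes B=[a_{ij}B]_{i,j=1}^n$ is the operator matrix acting on $\mathcal{H}^n$; it lies in $\mathcal{B}_{(I_n\otimes P)^{1/2}}(\mathcal{H}^n)$ when $B\in\mathcal{B}_{P^{1/2}}(\mathcal{H})$. For a matrix $C$, $w(C)=\sup\{|\langle Cx,x\rangle| : x\in\mathbb{C}^n,\ \|x\|=1\}$ is the usual numerical radius. *)

theory Defs
  imports "HOL-Analysis.Analysis"
begin

text \<open>
  Complex inner product spaces, with the inner product linear in its first argument.  The
  underlying real structure is the one of \<^class>\<open>real_inner\<close>: the real inner product is the real
  part of the complex one, which yields positive definiteness, the norm
  (the square root of \<open>cinner x x\<close>) and the topology.
\<close>

class complex_inner = real_inner +
  fixes scaleC :: "complex \<Rightarrow> 'a \<Rightarrow> 'a"  (infixr \<open>*\<^sub>C\<close> 75)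
    and cinner :: "'a \<Rightarrow> 'a \<Rightarrow> complex"
  assumes scaleC_add_right: "c *\<^sub>C (x + y) = c *\<^sub>C x + c *\<^sub>C y"
    and scaleC_add_left: "(c + d) *\<^sub>C x = c *\<^sub>C x + d *\<^sub>C x"
    and scaleC_scaleC: "c *\<^sub>C d *\<^sub>C x = (c * d) *\<^sub>C x"
    and scaleR_scaleC: "r *\<^sub>R x = complex_of_real r *\<^sub>C x"
    and cinner_commute: "cinner x y = cnj (cinner y x)"
    and cinner_add_left: "cinner (x + y) z = cinner x z + cinner y z"
    and cinner_scaleC_left: "cinner (c *\<^sub>C x) y = c * cinner x y"
    and inner_eq_Re_cinner: "inner x y = Re (cinner x y)"

class chilbert_space = complex_inner + complete_space

lemma cinner_self: "cinner x x = complex_of_real ((norm x)\<^sup>2)"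
proof -
  have "Im (cinner x x) = 0"
    using cinner_commute[of x x] by (simp add: complex_eq_iff)
  then show ?thesis
    by (simp add: complex_eq_iff power2_norm_eq_inner inner_eq_Re_cinner del: of_real_power)
qed

instantiation complex :: chilbert_space
begin

definition scaleC_complex :: "complex \<Rightarrow> complex \<Rightarrow> complex"
  where "scaleC_complex c z = c * z"

definition cinner_complex :: "complex \<Rightarrow> complex \<Rightarrow> complex"
  where "cinner_complex z w = z * cnj w"

instance
  by standard
    (simp_all add: scaleC_complex_def cinner_complex_def algebra_simps scaleR_conv_of_real
      inner_complex_def)

end

text \<open>The Hilbert space direct sum of copies of a space, indexed by a finite type.\<close>

instantiation vec :: (complex_inner, finite) complex_inner
begin

definition scaleC_vec :: "complex \<Rightarrow> 'a ^ 'b \<Rightarrow> 'a ^ 'b"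
  where "scaleC_vec c x = (\<chi> i. c *\<^sub>C (x $ i))"

definition cinner_vec :: "'a ^ 'b \<Rightarrow> 'a ^ 'b \<Rightarrow> complex"
  where "cinner_vec x y = (\<Sum>i\<in>UNIV. cinner (x $ i) (y $ i))"

instance
proof
  fix x y z :: "'a ^ 'b" and c d :: complex and r :: real
  show "c *\<^sub>C (x + y) = c *\<^sub>C x + c *\<^sub>C y"
    by (simp add: scaleC_vec_def vec_eq_iff scaleC_add_right)
  show "(c + d) *\<^sub>C x = c *\<^sub>C x + d *\<^sub>C x"
    by (simp add: scaleC_vec_def vec_eq_iff scaleC_add_left)
  show "c *\<^sub>C d *\<^sub>C x = (c * d) *\<^sub>C x"
    by (simp add: scaleC_vec_def vec_eq_iff scaleC_scaleC)
  show "r *\<^sub>R x = complex_of_real r *\<^sub>C x"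
    by (simp add: scaleC_vec_def vec_eq_iff scaleR_scaleC)
  show "cinner x y = cnj (cinner y x)"
    unfolding cinner_vec_def cnj_sum by (rule sum.cong[OF refl]) (rule cinner_commute)
  show "cinner (x + y) z = cinner x z + cinner y z"
    by (simp add: cinner_vec_def cinner_add_left sum.distrib)
  show "cinner (c *\<^sub>C x) y = c * cinner x y"
    by (simp add: cinner_vec_def scaleC_vec_def cinner_scaleC_left sum_distrib_left)
  show "inner x y = Re (cinner x y)"
    by (simp add: cinner_vec_def inner_vec_def inner_eq_Re_cinner)
qed

end

instance vec :: (chilbert_space, finite) chilbert_space ..

definition bounded_clinear :: "('a::complex_inner \<Rightarrow> 'a) \<Rightarrow> bool"
  where "bounded_clinear T \<longleftrightarrow> bounded_linear T \<and> (\<forall>c x. T (c *\<^sub>C x) = c *\<^sub>C T x)"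

definition positive_op :: "('a::complex_inner \<Rightarrow> 'a) \<Rightarrow> bool"
  where "positive_op P \<longleftrightarrow> bounded_clinear P \<and> (\<forall>x. cinner (P x) x \<in> \<real>\<^sub>\<ge>\<^sub>0)"

definition semi_cinner :: "('a::complex_inner \<Rightarrow> 'a) \<Rightarrow> 'a \<Rightarrow> 'a \<Rightarrow> complex"
  where "semi_cinner P x y = cinner (P x) y"

definition semi_norm :: "('a::complex_inner \<Rightarrow> 'a) \<Rightarrow> 'a \<Rightarrow> real"
  where "semi_norm P x = sqrt (Re (semi_cinner P x x))"

text \<open>The algebra usually written \<open>B\<close> with index the square root of \<open>P\<close>.\<close>

definition semi_bounded_ops :: "('a::complex_inner \<Rightarrow> 'a) \<Rightarrow> ('a \<Rightarrow> 'a) set"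
  where "semi_bounded_ops P =
    {B. bounded_clinear B \<and> (\<exists>l>0. \<forall>x. semi_norm P (B x) \<le> l * semi_norm P x)}"

text \<open>
  The supremum is taken in the reals; it is the true supremum because for positive nonzero \<open>P\<close>
  and \<open>B \<in> semi_bounded_ops P\<close> the set is nonempty and bounded.
\<close>

definition semi_numerical_radius :: "('a::complex_inner \<Rightarrow> 'a) \<Rightarrow> ('a \<Rightarrow> 'a) \<Rightarrow> real"
  where "semi_numerical_radius P B =
    (SUP x\<in>{x. semi_norm P x = 1}. cmod (semi_cinner P (B x) x))"

definition numerical_radius :: "complex ^ 'n ^ 'n \<Rightarrow> real"
  where "numerical_radius C = (SUP x\<in>{x. norm x = 1}. cmod (cinner (C *v x) x))"

text \<open>
  The operator matrix with blocks \<open>A $ i $ j\<close> times \<open>B\<close>, where \<open>A $ i $ j\<close> is the entry in row \<open>i\<close>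
  and column \<open>j\<close>.
\<close>

definition mat_tensor ::
    "complex ^ 'n ^ 'n \<Rightarrow> ('a::complex_inner \<Rightarrow> 'a) \<Rightarrow> 'a ^ 'n \<Rightarrow> 'a ^ 'n"  (infixr \<open>\<otimes>\<^sub>M\<close> 70)
  where "(A \<otimes>\<^sub>M B) x = (\<chi> i. \<Sum>j\<in>UNIV. (A $ i $ j) *\<^sub>C B (x $ j))"

lemma mat_1_tensor:
  fixes P :: "'a::complex_inner \<Rightarrow> 'a" and x :: "'a ^ 'n"
  shows "(mat 1 \<otimes>\<^sub>M P) x = (\<chi> i. P (x $ i))"
proof -
  have one: "1 *\<^sub>C y = y" for y :: 'a
    using scaleR_scaleC[of 1 y] by simp
  have zero: "0 *\<^sub>C y = 0" for y :: 'a
    using scaleR_scaleC[of 0 y] by simp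
  have "(\<Sum>j\<in>UNIV. (mat 1 :: complex ^ 'n ^ 'n) $ i $ j *\<^sub>C P (x $ j))
      = (\<Sum>j\<in>UNIV. if i = j then P (x $ j) else 0)" for i
    by (rule sum.cong) (auto simp: mat_def one zero)
  then show ?thesis
    by (simp add: mat_tensor_def vec_eq_iff)
qed

end

theory Submission
  imports Defs
begin

text \<open>
  For a vector \<open>x\<close> of the direct sum put \<open>t\<^sub>i = \<parallel>x\<^sub>i\<parallel>\<close>, where norms and inner products are those
  induced by \<open>P\<close>.  The form \<open>\<langle>(A \<otimes> B) x, x\<rangle>\<close> is the sum of the \<open>a\<^sub>i\<^sub>j \<langle>B x\<^sub>j, x\<^sub>i\<rangle>\<close>.  Adding to it
  the same sum with \<open>i\<close> and \<open>j\<close> exchanged groups the terms into pairs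
  \<open>a\<^sub>i\<^sub>j \<langle>B x\<^sub>j, x\<^sub>i\<rangle> + a\<^sub>j\<^sub>i \<langle>B x\<^sub>i, x\<^sub>j\<rangle>\<close>, each of which is the form of the off-diagonal
  two by two operator matrix at \<open>(x\<^sub>i, x\<^sub>j)\<close>.  The definition of the numerical radius bounds a pair
  only by \<open>c\<^sub>i\<^sub>j (t\<^sub>i\<^sup>2 + t\<^sub>j\<^sup>2)\<close>.  The pair does not change, however, when one of the two vectors is
  multiplied by a positive number and the other is divided by it; balancing the two norms in this
  way improves the bound to \<open>2 c\<^sub>i\<^sub>j t\<^sub>i t\<^sub>j\<close> (lemma \<open>offdiag_pair_bound\<close>).  The diagonal pairs
  satisfy the same bound.  Summation gives \<open>\<bar>\<langle>(A \<otimes> B) x, x\<rangle>\<bar> \<le> \<langle>C t, t\<rangle>\<close>, and \<open>t\<close> is a unit vector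
  of \<open>\<complex>\<^sup>n\<close> when \<open>x\<close> is a unit vector of the direct sum.

  What remains is to see that the suprema are genuine.  They are taken over bounded sets by the
  Cauchy--Schwarz inequality for the semi-inner product, which also settles the case \<open>t\<^sub>i t\<^sub>j = 0\<close>,
  where balancing is impossible; and there are unit vectors because a positive operator with
  vanishing quadratic form vanishes.
\<close>

section \<open>Complex inner products\<close>

lemma cinner_zero_left [simp]: "cinner 0 x = 0"
  using cinner_add_left[of 0 0 x] by simp

lemma cinner_sum_left: "cinner (\<Sum>i\<in>S. f i) x = (\<Sum>i\<in>S. cinner (f i) x)"
  by (induction S rule: infinite_finite_induct) (simp_all add: cinner_add_left)

lemma cinner_add_right: "cinner x (y + z) = cinner x y + cinner x z"
  by (metis cinner_add_left cinner_commute complex_cnj_add)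

lemma cinner_scaleC_right: "cinner x (c *\<^sub>C y) = cnj c * cinner x y"
  by (metis cinner_scaleC_left cinner_commute complex_cnj_mult)

lemma scaleC_zero_right [simp]: "c *\<^sub>C 0 = (0 :: 'a::complex_inner)"
  using scaleC_add_right[of c 0 0] by simp

lemma bounded_clinear_add: "bounded_clinear T \<Longrightarrow> T (x + y) = T x + T y"
  by (simp add: bounded_clinear_def linear_simps)

lemma bounded_clinear_scaleC: "bounded_clinear T \<Longrightarrow> T (c *\<^sub>C x) = c *\<^sub>C T x"
  by (simp add: bounded_clinear_def)

section \<open>The semi-inner product of a positive operator\<close>

lemma semi_cinner_expand:
  assumes "bounded_clinear P"
  shows "semi_cinner P (x + c *\<^sub>C y) (x + c *\<^sub>C y) = semi_cinner P x x
    + cnj c * semi_cinner P x y + c * semi_cinner P y x + c * cnj c * semi_cinner P y y"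
  using assms
  by (simp add: semi_cinner_def bounded_clinear_add bounded_clinear_scaleC cinner_add_left
      cinner_add_right cinner_scaleC_left cinner_scaleC_right algebra_simps)

lemma semi_cinner_self_nonneg:
  assumes "positive_op P"
  shows "Re (semi_cinner P x x) \<ge> 0" and "Im (semi_cinner P x x) = 0"
  using assms by (auto simp: positive_op_def semi_cinner_def complex_nonneg_Reals_iff)

lemma semi_norm_nonneg: "positive_op P \<Longrightarrow> semi_norm P x \<ge> 0"
  by (simp add: semi_norm_def semi_cinner_self_nonneg)

lemma semi_cinner_self:
  "positive_op P \<Longrightarrow> semi_cinner P x x = complex_of_real ((semi_norm P x)\<^sup>2)"
  by (simp add: complex_eq_iff semi_norm_def semi_cinner_self_nonneg)

text \<open>
  Over the complex numbers, a form with real diagonal is Hermitian: it suffices to expand it at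
  \<open>x + y\<close> and at \<open>x + \<i> y\<close> and to compare imaginary parts.
\<close>

lemma semi_cinner_commute:
  assumes "positive_op P"
  shows "semi_cinner P y x = cnj (semi_cinner P x y)"
proof -
  have P: "bounded_clinear P"
    using assms by (simp add: positive_op_def)
  have "Im (semi_cinner P (x + c *\<^sub>C y) (x + c *\<^sub>C y)) = 0" for c
    by (rule semi_cinner_self_nonneg[OF assms])
  from this[of 1] this[of \<i>] show ?thesis
    unfolding semi_cinner_expand[OF P]
    by (simp add: complex_eq_iff semi_cinner_self_nonneg[OF assms])
qed

lemma semi_Cauchy_Schwarz:
  assumes "positive_op P"
  shows "cmod (semi_cinner P x y) \<le> semi_norm P x * semi_norm P y"
proof -
  define z where "z = semi_cinner P x y"
  define p where "p = (semi_norm P x)\<^sup>2"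
  define q where "q = (semi_norm P y)\<^sup>2"
  have P: "bounded_clinear P"
    using assms by (simp add: positive_op_def)
  \<comment> \<open>The form is nonnegative on the line through \<open>x\<close> in the direction of \<open>z y\<close>.\<close>
  have quad: "0 \<le> p + 2 * t * (cmod z)\<^sup>2 + t\<^sup>2 * (cmod z)\<^sup>2 * q" for t :: real
  proof -
    let ?u = "x + (complex_of_real t * z) *\<^sub>C y"
    have "semi_cinner P ?u ?u
        = complex_of_real (p + 2 * t * (cmod z)\<^sup>2 + t\<^sup>2 * (cmod z)\<^sup>2 * q)"
      unfolding semi_cinner_expand[OF P]
        semi_cinner_commute[OF assms, of y x] semi_cinner_self[OF assms, of x] semi_cinner_self[OF assms, of y]
      by (simp add: z_def[symmetric] p_def[symmetric] q_def[symmetric] complex_norm_square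
          power2_eq_square[of t] algebra_simps del: of_real_power)
    then show ?thesis
      using semi_cinner_self_nonneg(1)[OF assms, of ?u] by simp
  qed
  have "(cmod z)\<^sup>2 \<le> p * q"
  proof (cases "q = 0")
    case True
    have "z = 0"
    proof (rule ccontr)
      assume "z \<noteq> 0"
      \<comment> \<open>The polynomial in \<open>t\<close> is affine and not constant, so it takes a negative value.\<close>
      then have "p + 2 * (- (p + 1) / (cmod z)\<^sup>2) * (cmod z)\<^sup>2 = - p - 2"
        by (simp add: field_simps)
      then show False
        using quad[of "- (p + 1) / (cmod z)\<^sup>2"] True by (simp add: p_def)
           (smt (verit) zero_le_power2)
    qed
    then show ?thesis
      by (simp add: True)
  next
    case False
    then have "q > 0"
      by (simp add: q_def)
    \<comment> \<open>The quadratic polynomial attains its minimum at \<open>- 1 / q\<close>.\<close>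
    then have "p + 2 * (- 1 / q) * (cmod z)\<^sup>2 + (- 1 / q)\<^sup>2 * (cmod z)\<^sup>2 * q = p - (cmod z)\<^sup>2 / q"
      by (simp add: field_simps power2_eq_square)
    then have "(cmod z)\<^sup>2 / q \<le> p"
      using quad[of "- 1 / q"] by simp
    then show ?thesis
      using \<open>q > 0\<close> by (simp add: field_simps)
  qed
  then have "(cmod z)\<^sup>2 \<le> (semi_norm P x * semi_norm P y)\<^sup>2"
    by (simp add: p_def q_def power_mult_distrib)
  then show ?thesis
    unfolding z_def by (rule power2_le_imp_le) (simp add: semi_norm_nonneg[OF assms])
qed

lemma semi_norm_scaleC:
  assumes "bounded_clinear P"
  shows "semi_norm P (c *\<^sub>C x) = cmod c * semi_norm P x"
proof -
  have "semi_cinner P (c *\<^sub>C x) (c *\<^sub>C x) = complex_of_real ((cmod c)\<^sup>2) * semi_cinner P x x"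
    using assms unfolding complex_norm_square
    by (simp add: semi_cinner_def bounded_clinear_scaleC cinner_scaleC_left cinner_scaleC_right)
  then show ?thesis
    by (simp add: semi_norm_def real_sqrt_mult del: of_real_power)
qed

lemma exists_semi_unit_vector:
  assumes "positive_op P" and "P \<noteq> (\<lambda>x. 0)"
  obtains x where "semi_norm P x = 1"
proof -
  have P: "bounded_clinear P"
    using assms by (simp add: positive_op_def)
  have "\<exists>x. semi_norm P x \<noteq> 0"
  proof (rule ccontr)
    assume "\<not> ?thesis"
    then have "cinner (P x) (P x) = 0" for x
      using semi_Cauchy_Schwarz[OF assms(1), of x "P x"] by (simp add: semi_cinner_def)
    then have "P x = 0" for x
      by (simp add: cinner_self)
    with assms(2) show False
      by auto
  qed
  then obtain x where x: "semi_norm P x \<noteq> 0"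
    by auto
  show ?thesis
  proof
    show "semi_norm P (complex_of_real (1 / semi_norm P x) *\<^sub>C x) = 1"
      using x semi_norm_nonneg[OF assms(1), of x]
      by (simp add: semi_norm_scaleC[OF P] norm_divide)
  qed
qed

section \<open>Forms bounded by the square of the seminorm\<close>

lemma cmod_le_semi_numerical_radius:
  assumes bound: "\<And>x. cmod (semi_cinner P (T x) x) \<le> K * (semi_norm P x)\<^sup>2"
    and "semi_norm P x = 1"
  shows "cmod (semi_cinner P (T x) x) \<le> semi_numerical_radius P T"
  unfolding semi_numerical_radius_def
proof (rule cSUP_upper)
  show "bdd_above ((\<lambda>x. cmod (semi_cinner P (T x) x)) ` {x. semi_norm P x = 1})"
  proof (rule bdd_aboveI2[where M = K])
    fix x assume "x \<in> {x. semi_norm P x = 1}"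
    then show "cmod (semi_cinner P (T x) x) \<le> K"
      using bound[of x] by simp
  qed
qed (simp add: assms)

text \<open>
  Vectors of positive seminorm can be normalised.  On the others the form vanishes by the
  boundedness hypothesis, for any value of \<open>K\<close>.
\<close>

lemma cmod_le_semi_numerical_radius_mult:
  assumes P: "bounded_clinear P" and T: "bounded_clinear T"
    and bound: "\<And>x. cmod (semi_cinner P (T x) x) \<le> K * (semi_norm P x)\<^sup>2"
    and nonneg: "semi_norm P x \<ge> 0"
  shows "cmod (semi_cinner P (T x) x) \<le> semi_numerical_radius P T * (semi_norm P x)\<^sup>2"
proof (cases "semi_norm P x = 0")
  case True
  then show ?thesis
    using bound[of x] by simp
next
  case False
  define r where "r = semi_norm P x"
  define y where "y = complex_of_real (1 / r) *\<^sub>C x"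
  have r: "r > 0"
    using False nonneg by (simp add: r_def)
  have "semi_norm P y = 1"
    using r by (simp add: y_def semi_norm_scaleC[OF P] r_def[symmetric] norm_divide)
  with bound have "cmod (semi_cinner P (T y) y) \<le> semi_numerical_radius P T"
    by (rule cmod_le_semi_numerical_radius)
  moreover have "semi_cinner P (T y) y = complex_of_real (1 / r\<^sup>2) * semi_cinner P (T x) x"
    by (simp add: y_def semi_cinner_def bounded_clinear_scaleC[OF P] bounded_clinear_scaleC[OF T]
        cinner_scaleC_left cinner_scaleC_right power2_eq_square)
  ultimately show ?thesis
    using r by (simp add: r_def[symmetric] norm_mult norm_divide norm_power field_simps)
qed

text \<open>
  The algebra of operators is defined by a bound on \<open>\<parallel>B x\<parallel>\<close>, and Cauchy--Schwarz turns it into a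
  bound on the form.
\<close>

lemma semi_bounded_form:
  assumes "positive_op P" and "B \<in> semi_bounded_ops P"
  shows "\<exists>l>0. \<forall>x y. cmod (semi_cinner P (B x) y) \<le> l * (semi_norm P x * semi_norm P y)"
proof -
  obtain l where l: "l > 0" "\<And>x. semi_norm P (B x) \<le> l * semi_norm P x"
    using assms(2) by (auto simp: semi_bounded_ops_def)
  have "cmod (semi_cinner P (B x) y) \<le> l * (semi_norm P x * semi_norm P y)" for x y
  proof -
    have "cmod (semi_cinner P (B x) y) \<le> semi_norm P (B x) * semi_norm P y"
      by (rule semi_Cauchy_Schwarz[OF assms(1)])
    also have "\<dots> \<le> (l * semi_norm P x) * semi_norm P y"
      by (intro mult_right_mono l semi_norm_nonneg[OF assms(1)])
    finally show ?thesis
      by (simp add: mult.assoc)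
  qed
  with l(1) show ?thesis
    by auto
qed

lemma cmod_form_le_semi_numerical_radius:
  assumes "positive_op P" and "B \<in> semi_bounded_ops P"
  shows "cmod (semi_cinner P (B x) x) \<le> semi_numerical_radius P B * (semi_norm P x)\<^sup>2"
proof -
  have "bounded_clinear P" and "bounded_clinear B"
    using assms by (simp_all add: positive_op_def semi_bounded_ops_def)
  moreover obtain l where "\<forall>x y. cmod (semi_cinner P (B x) y) \<le> l * (semi_norm P x * semi_norm P y)"
    using semi_bounded_form[OF assms] by blast
  then have "cmod (semi_cinner P (B x) x) \<le> l * (semi_norm P x)\<^sup>2" for x
    by (simp add: power2_eq_square)
  ultimately show ?thesis
    by (rule cmod_le_semi_numerical_radius_mult) (rule semi_norm_nonneg[OF assms(1)])
qed

section \<open>Operator matrices on the direct sum\<close>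

lemma bounded_linear_scaleC: "bounded_linear (\<lambda>x::'a::complex_inner. c *\<^sub>C x)"
proof (rule bounded_linear_intro[where K = "cmod c"])
  fix x :: 'a and r :: real
  show "c *\<^sub>C r *\<^sub>R x = r *\<^sub>R c *\<^sub>C x"
    by (simp add: scaleR_scaleC scaleC_scaleC mult.commute)
  have "complex_of_real ((norm (c *\<^sub>C x))\<^sup>2) = complex_of_real ((norm x * cmod c)\<^sup>2)"
    by (simp add: cinner_self[symmetric, of "c *\<^sub>C x"] cinner_self[symmetric, of x]
        power_mult_distrib complex_norm_square cinner_scaleC_left cinner_scaleC_right
        del: of_real_power)
  then show "norm (c *\<^sub>C x) \<le> norm x * cmod c"
    by (simp add: power2_eq_iff_nonneg del: of_real_power of_real_mult)
qed (simp add: scaleC_add_right)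

lemma scaleC_sum_right: "c *\<^sub>C (\<Sum>i\<in>S. f i) = (\<Sum>i\<in>S. c *\<^sub>C (f i :: 'a::complex_inner))"
  by (rule linear_sum[OF bounded_linear.linear[OF bounded_linear_scaleC]])

lemma bounded_linear_vec_lambdaI:
  fixes f :: "'n::finite \<Rightarrow> 'a::real_normed_vector \<Rightarrow> 'b::real_normed_vector"
  assumes "\<And>i. bounded_linear (f i)"
  shows "bounded_linear (\<lambda>x. \<chi> i. f i x)"
proof -
  have "\<forall>i. \<exists>K. \<forall>x. norm (f i x) \<le> norm x * K"
    using assms bounded_linear.bounded by blast
  then obtain K where K: "\<And>i x. norm (f i x) \<le> norm x * K i"
    by metis
  show ?thesis
  proof (rule bounded_linear_intro[where K = "\<Sum>i\<in>UNIV. K i"])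
    fix x
    have "norm (\<chi> i. f i x) \<le> (\<Sum>i\<in>UNIV. norm (f i x))"
      unfolding norm_vec_def by (rule order_trans[OF L2_set_le_sum]) auto
    also have "\<dots> \<le> (\<Sum>i\<in>UNIV. norm x * K i)"
      by (intro sum_mono K)
    finally show "norm (\<chi> i. f i x) \<le> norm x * (\<Sum>i\<in>UNIV. K i)"
      by (simp add: sum_distrib_left)
  qed (simp_all add: vec_eq_iff linear_simps[OF assms])
qed

lemma bounded_clinear_mat_tensor:
  assumes "bounded_clinear B"
  shows "bounded_clinear (A \<otimes>\<^sub>M B)"
  unfolding bounded_clinear_def
proof
  have B: "bounded_linear B"
    using assms by (simp add: bounded_clinear_def)
  have row: "bounded_linear (\<lambda>x. \<Sum>j\<in>UNIV. A $ i $ j *\<^sub>C B (x $ j))" for i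
    by (intro bounded_linear_sum bounded_linear_compose[OF bounded_linear_scaleC]
        bounded_linear_compose[OF B] bounded_linear_vec_nth)
  then show "bounded_linear (A \<otimes>\<^sub>M B)"
    unfolding mat_tensor_def[abs_def] by (rule bounded_linear_vec_lambdaI)
  show "\<forall>c x. (A \<otimes>\<^sub>M B) (c *\<^sub>C x) = c *\<^sub>C (A \<otimes>\<^sub>M B) x"
    by (simp add: mat_tensor_def scaleC_vec_def vec_eq_iff bounded_clinear_scaleC[OF assms]
        scaleC_sum_right scaleC_scaleC mult.commute)
qed

lemma semi_cinner_mat_1_tensor:
  "semi_cinner (mat 1 \<otimes>\<^sub>M P) x y = (\<Sum>i\<in>UNIV. semi_cinner P (x $ i) (y $ i))"
  by (simp add: semi_cinner_def mat_1_tensor cinner_vec_def)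

lemma semi_norm_mat_1_tensor:
  assumes "positive_op P"
  shows "semi_norm (mat 1 \<otimes>\<^sub>M P) x = sqrt (\<Sum>i\<in>UNIV. (semi_norm P (x $ i))\<^sup>2)"
  by (simp add: semi_norm_def[of "mat 1 \<otimes>\<^sub>M P"] semi_cinner_mat_1_tensor semi_cinner_self[OF assms]
      del: of_real_power)

lemma semi_norm_mat_1_tensor_squared:
  assumes "positive_op P"
  shows "(semi_norm (mat 1 \<otimes>\<^sub>M P) x)\<^sup>2 = (\<Sum>i\<in>UNIV. (semi_norm P (x $ i))\<^sup>2)"
  by (simp add: semi_norm_mat_1_tensor[OF assms] sum_nonneg)

lemma semi_cinner_mat_tensor:
  assumes "bounded_clinear P"
  shows "semi_cinner (mat 1 \<otimes>\<^sub>M P) ((A \<otimes>\<^sub>M B) x) x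
    = (\<Sum>i\<in>UNIV. \<Sum>j\<in>UNIV. A $ i $ j * semi_cinner P (B (x $ j)) (x $ i))"
proof -
  have "P (\<Sum>j\<in>UNIV. f j) = (\<Sum>j\<in>UNIV. P (f j))" for f :: "'b \<Rightarrow> 'a"
    using assms unfolding bounded_clinear_def
    by (intro linear_sum bounded_linear.linear) simp
  then show ?thesis
    unfolding semi_cinner_mat_1_tensor
    by (simp add: mat_tensor_def semi_cinner_def cinner_sum_left
        bounded_clinear_scaleC[OF assms] cinner_scaleC_left)
qed

lemma mat_tensor_form_bounded:
  fixes A :: "complex ^ 'n ^ 'n"
  assumes "positive_op P" and "B \<in> semi_bounded_ops P"
  obtains K where "\<And>x. cmod (semi_cinner (mat 1 \<otimes>\<^sub>M P) ((A \<otimes>\<^sub>M B) x) x)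
    \<le> K * (semi_norm (mat 1 \<otimes>\<^sub>M P) x)\<^sup>2"
proof -
  have P: "bounded_clinear P"
    using assms by (simp add: positive_op_def)
  obtain l where l: "l > 0"
    "\<forall>x y. cmod (semi_cinner P (B x) y) \<le> l * (semi_norm P x * semi_norm P y)"
    using semi_bounded_form[OF assms] by blast
  show ?thesis
  proof
    fix x :: "'a ^ 'n"
    let ?N = "semi_norm (mat 1 \<otimes>\<^sub>M P) x"
    have N: "?N \<ge> 0"
      by (simp add: semi_norm_mat_1_tensor[OF assms(1)] sum_nonneg)
    have le: "semi_norm P (x $ i) \<le> ?N" for i
      unfolding semi_norm_mat_1_tensor[OF assms(1)]
      by (intro real_le_rsqrt member_le_sum) auto
    have "cmod (semi_cinner (mat 1 \<otimes>\<^sub>M P) ((A \<otimes>\<^sub>M B) x) x)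
        \<le> (\<Sum>i\<in>UNIV. \<Sum>j\<in>UNIV. cmod (A $ i $ j) * cmod (semi_cinner P (B (x $ j)) (x $ i)))"
      unfolding semi_cinner_mat_tensor[OF P] norm_mult[symmetric]
      by (intro order_trans[OF norm_sum] sum_mono order_refl)
    also have "\<dots> \<le> (\<Sum>i\<in>UNIV. \<Sum>j\<in>UNIV. cmod (A $ i $ j) * (l * (?N * ?N)))"
      using l(1) N le
      by (intro sum_mono mult_left_mono order_trans[OF l(2)[rule_format]] mult_mono semi_norm_nonneg[OF assms(1)]) auto
    also have "\<dots> = ((\<Sum>i\<in>UNIV. \<Sum>j\<in>UNIV. cmod (A $ i $ j)) * l) * ?N\<^sup>2"
      by (simp add: sum_distrib_right power2_eq_square mult.assoc)
    finally show "cmod (semi_cinner (mat 1 \<otimes>\<^sub>M P) ((A \<otimes>\<^sub>M B) x) x)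
        \<le> ((\<Sum>i\<in>UNIV. \<Sum>j\<in>UNIV. cmod (A $ i $ j)) * l) * ?N\<^sup>2" .
  qed
qed

section \<open>Balancing an off-diagonal pair\<close>

text \<open>
  The form of the two by two operator matrix is evaluated at \<open>(\<parallel>y\<parallel> x, \<parallel>x\<parallel> y)\<close>, whose components have
  the same seminorm.  The scalars multiply the left-hand side by \<open>\<parallel>x\<parallel> \<parallel>y\<parallel>\<close>, while the squared
  seminorm of this vector is \<open>2 \<parallel>x\<parallel>\<^sup>2 \<parallel>y\<parallel>\<^sup>2\<close>.
\<close>

lemma offdiag_pair_bound:
  fixes a b :: complex
  assumes "positive_op P" and "B \<in> semi_bounded_ops P"
  shows "cmod (a * semi_cinner P (B y) x + b * semi_cinner P (B x) y)
    \<le> 2 * semi_numerical_radius ((mat 1 :: complex ^ 2 ^ 2) \<otimes>\<^sub>M P)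
          ((vector [vector [0, a], vector [b, 0]] :: complex ^ 2 ^ 2) \<otimes>\<^sub>M B)
        * (semi_norm P x * semi_norm P y)"
    (is "cmod ?z \<le> 2 * semi_numerical_radius ?Q ?T * _")
proof (cases "semi_norm P x * semi_norm P y = 0")
  case True
  obtain l where l: "\<forall>x y. cmod (semi_cinner P (B x) y) \<le> l * (semi_norm P x * semi_norm P y)"
    using semi_bounded_form[OF assms] by blast
  from l[rule_format, of x y] l[rule_format, of y x] True have "?z = 0"
    by (simp add: mult.commute)
  then show ?thesis
    unfolding True by simp
next
  case False
  define r s where "r = semi_norm P x" and "s = semi_norm P y"
  have rs: "r * s > 0"
    using False semi_norm_nonneg[OF assms(1), of x] semi_norm_nonneg[OF assms(1), of y]
    by (simp add: r_def s_def)
  have P: "bounded_clinear P" and B: "bounded_clinear B"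
    using assms by (simp_all add: positive_op_def semi_bounded_ops_def)
  define v :: "'a ^ 2" where "v = vector [complex_of_real s *\<^sub>C x, complex_of_real r *\<^sub>C y]"
  obtain K where K: "\<And>u. cmod (semi_cinner ?Q (?T u) u) \<le> K * (semi_norm ?Q u)\<^sup>2"
    using mat_tensor_form_bounded[OF assms] by blast
  have "cmod (semi_cinner ?Q (?T v) v) \<le> semi_numerical_radius ?Q ?T * (semi_norm ?Q v)\<^sup>2"
    by (rule cmod_le_semi_numerical_radius_mult
        [OF bounded_clinear_mat_tensor[OF P] bounded_clinear_mat_tensor[OF B] K])
       (simp add: semi_norm_mat_1_tensor[OF assms(1)] sum_nonneg)
  moreover have "semi_cinner ?Q (?T v) v = complex_of_real (r * s) * ?z"
    unfolding semi_cinner_mat_tensor[OF P]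
    by (simp add: UNIV_2 v_def semi_cinner_def bounded_clinear_scaleC[OF P]
        bounded_clinear_scaleC[OF B] cinner_scaleC_left cinner_scaleC_right algebra_simps)
  moreover have "(semi_norm ?Q v)\<^sup>2 = 2 * (r * s)\<^sup>2"
    unfolding semi_norm_mat_1_tensor_squared[OF assms(1)]
    by (simp add: UNIV_2 v_def semi_norm_scaleC[OF P] r_def[symmetric] s_def[symmetric]
        power_mult_distrib)
  ultimately have "cmod (complex_of_real (r * s) * ?z) \<le> semi_numerical_radius ?Q ?T * (2 * (r * s)\<^sup>2)"
    by simp
  then have "(r * s) * cmod ?z \<le> (r * s) * (2 * semi_numerical_radius ?Q ?T * (r * s))"
    unfolding norm_mult norm_of_real using rs by (simp add: power2_eq_square mult_ac)
  then show ?thesis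
    unfolding r_def[symmetric] s_def[symmetric] using rs mult_le_cancel_left_pos by blast
qed

section \<open>Comparison with the matrix of numerical radii\<close>

lemma cinner_matrix_vector_mult:
  "cinner (C *v t) t = (\<Sum>i\<in>UNIV. \<Sum>j\<in>UNIV. C $ i $ j * t $ j * cnj (t $ i))"
  by (simp add: cinner_vec_def cinner_complex_def matrix_vector_mult_def sum_distrib_right)

lemma cmod_le_numerical_radius:
  fixes C :: "complex ^ 'n ^ 'n"
  assumes "norm t = 1"
  shows "cmod (cinner (C *v t) t) \<le> numerical_radius C"
  unfolding numerical_radius_def
proof (rule cSUP_upper)
  have "cmod (cinner (C *v x) x) \<le> (\<Sum>i\<in>UNIV. \<Sum>j\<in>UNIV. cmod (C $ i $ j))"
    if "norm x = 1" for x
  proof -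
    have le: "cmod (x $ i) \<le> 1" for i
      using Finite_Cartesian_Product.norm_nth_le[of x i] that by simp
    have "cmod (C $ i $ j * x $ j * cnj (x $ i)) \<le> cmod (C $ i $ j)" for i j
      using mult_mono[OF le[of j] le[of i]] mult_left_mono[of _ 1 "cmod (C $ i $ j)"]
      by (simp add: norm_mult mult.assoc)
    then show ?thesis
      unfolding cinner_matrix_vector_mult
      by (intro order_trans[OF norm_sum] sum_mono) auto
  qed
  then show "bdd_above ((\<lambda>x. cmod (cinner (C *v x) x)) ` {x. norm x = 1})"
    by (intro bdd_aboveI2) auto
qed (simp add: assms)

text \<open>
  Averaging the form with its transpose, as in the hypothesis, avoids ordering the index set.
\<close>

lemma cmod_double_sum_le:
  fixes f :: "'n::finite \<Rightarrow> 'n \<Rightarrow> complex"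
  assumes "\<And>i j. cmod (f i j + f j i) \<le> 2 * g i j"
  shows "cmod (\<Sum>i\<in>UNIV. \<Sum>j\<in>UNIV. f i j) \<le> (\<Sum>i\<in>UNIV. \<Sum>j\<in>UNIV. g i j)"
proof -
  have "2 * (\<Sum>i\<in>UNIV. \<Sum>j\<in>UNIV. f i j) = (\<Sum>i\<in>UNIV. \<Sum>j\<in>UNIV. f i j + f j i)"
    using sum.swap[of f UNIV UNIV] by (simp add: sum.distrib)
  then have "2 * cmod (\<Sum>i\<in>UNIV. \<Sum>j\<in>UNIV. f i j) = cmod (\<Sum>i\<in>UNIV. \<Sum>j\<in>UNIV. f i j + f j i)"
    by (metis norm_mult norm_numeral)
  also have "\<dots> \<le> (\<Sum>i\<in>UNIV. \<Sum>j\<in>UNIV. 2 * g i j)"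
    by (intro order_trans[OF norm_sum] sum_mono assms)
  finally show ?thesis
    by (simp flip: sum_distrib_left)
qed

theorem theorem3p7:
  fixes P B :: "'a::chilbert_space \<Rightarrow> 'a"
    and A :: "complex ^ 'n ^ 'n"
  assumes "positive_op P"
    and "P \<noteq> (\<lambda>x. 0)"
    and "B \<in> semi_bounded_ops P"
  shows "semi_numerical_radius (mat 1 \<otimes>\<^sub>M P) (A \<otimes>\<^sub>M B)
    \<le> numerical_radius (\<chi> i j. complex_of_real
        (if i = j then cmod (A $ i $ i) * semi_numerical_radius P B
         else semi_numerical_radius ((mat 1 :: complex ^ 2 ^ 2) \<otimes>\<^sub>M P)
           ((vector [vector [0, A $ i $ j], vector [A $ j $ i, 0]] :: complex ^ 2 ^ 2) \<otimes>\<^sub>M B)))"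
proof -
  let ?Q = "(mat 1 :: complex ^ 'n ^ 'n) \<otimes>\<^sub>M P"
  define c where "c i j = (if i = j then cmod (A $ i $ i) * semi_numerical_radius P B
      else semi_numerical_radius ((mat 1 :: complex ^ 2 ^ 2) \<otimes>\<^sub>M P)
        ((vector [vector [0, A $ i $ j], vector [A $ j $ i, 0]] :: complex ^ 2 ^ 2) \<otimes>\<^sub>M B))"
    for i j
  define C :: "complex ^ 'n ^ 'n" where "C = (\<chi> i j. complex_of_real (c i j))"
  have P: "bounded_clinear P"
    using assms(1) by (simp add: positive_op_def)
  have diag: "cmod (semi_cinner P (B y) y) \<le> semi_numerical_radius P B * (semi_norm P y)\<^sup>2" for y
    by (rule cmod_form_le_semi_numerical_radius[OF assms(1,3)])
  have "cmod (semi_cinner ?Q ((A \<otimes>\<^sub>M B) x) x) \<le> numerical_radius C" if x: "semi_norm ?Q x = 1" for x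
  proof -
    define t :: "complex ^ 'n" where "t = (\<chi> i. complex_of_real (semi_norm P (x $ i)))"
    have pair: "cmod (A $ i $ j * semi_cinner P (B (x $ j)) (x $ i)
          + A $ j $ i * semi_cinner P (B (x $ i)) (x $ j))
        \<le> 2 * (c i j * (semi_norm P (x $ i) * semi_norm P (x $ j)))" for i j
    proof (cases "i = j")
      case True
      have "cmod (z + z) = 2 * cmod z" for z :: complex
        by (metis mult_2 norm_mult norm_numeral)
      with True show ?thesis
        using mult_left_mono[OF diag[of "x $ i"], of "cmod (A $ i $ i)"]
        by (simp add: c_def norm_mult power2_eq_square mult.assoc)
    next
      case False
      then show ?thesis
        using offdiag_pair_bound[OF assms(1,3), of "A $ i $ j" "x $ j" "x $ i" "A $ j $ i"]
        by (simp add: c_def mult.assoc)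
    qed
    have "cmod (semi_cinner ?Q ((A \<otimes>\<^sub>M B) x) x)
        \<le> (\<Sum>i\<in>UNIV. \<Sum>j\<in>UNIV. c i j * (semi_norm P (x $ i) * semi_norm P (x $ j)))"
      unfolding semi_cinner_mat_tensor[OF P] by (rule cmod_double_sum_le) (rule pair)
    also have "\<dots> = Re (cinner (C *v t) t)"
      by (simp add: cinner_matrix_vector_mult C_def t_def mult_ac)
    also have "\<dots> \<le> cmod (cinner (C *v t) t)"
      by (rule complex_Re_le_cmod)
    also have "\<dots> \<le> numerical_radius C"
    proof (rule cmod_le_numerical_radius)
      show "norm t = 1"
        using x unfolding semi_norm_mat_1_tensor[OF assms(1)]
        by (simp add: norm_vec_def L2_set_def t_def)
    qed
    finally show ?thesis .
  qed
  moreover have "{x. semi_norm ?Q x = 1} \<noteq> {}"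
  proof -
    obtain y where y: "semi_norm P y = 1"
      using exists_semi_unit_vector[OF assms(1,2)] .
    fix k :: 'n
    have "semi_norm P 0 = 0"
      using semi_norm_scaleC[OF P, of 0 0] by simp
    then have "(\<Sum>i\<in>UNIV. (semi_norm P (axis k y $ i))\<^sup>2) = (\<Sum>i\<in>UNIV. if i = k then 1 else 0)"
      by (intro sum.cong) (auto simp: axis_def y)
    then have "semi_norm ?Q (axis k y) = 1"
      by (simp add: semi_norm_mat_1_tensor[OF assms(1)])
    then show ?thesis
      by auto
  qed
  ultimately have "semi_numerical_radius ?Q (A \<otimes>\<^sub>M B) \<le> numerical_radius C"
    unfolding semi_numerical_radius_def[of ?Q] by (intro cSUP_least) auto
  then show ?thesis
    unfolding C_def c_def .
qed

end
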